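(* Suppose $2\le k_1$ and $2\le t\le\min\{k_2,d\}$. Then the ideal $I_\emptyset$ is prime.
   Context: Let $k_1,k_2,d,t$ be integers as in the claim; $[n]=\{1,\dots,n\}$. Let $X=(x_{i(j,\ell)})$ be the $d\times k_1k_2$ matrix of indeterminates with rows $i\in[d]$ and columns $(j,\ell)\in[k_1]\times[k_2]$, and $\mathbb C[X]$ the polynomial ring over $\mathbb C$ in its entries. For $i\in[k_2]$ let $C_i=[k_1]\times\{i\}$ and let $X_{C_i}$ be the submatrix of $X$ with columns in $C_i$. For a submatrix $Y$ of $X$, $I_r(Y)\subseteq\mathbb C[X]$ is the ideal generated by all $r$-minors of $Y$. Define $I_\emptyset=I_t(X)+\sum_{i=1}^{k_2}I_2(X_{C_i})\subseteq\mathbb C[X]$. *)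

theory Defs
  imports
    "HOL-Library.Poly_Mapping"
    "HOL-Algebra.Ideal"
    "Jordan_Normal_Form.Determinant"
begin

text \<open>
  An index \<open>(i, (j, l))\<close> stands for the indeterminate in row \<open>i\<close> and column \<open>(j, l)\<close>.
  Polynomials are finitely supported maps from monomials (exponent vectors) to coefficients.
  The type provides infinitely many indeterminates; the polynomial ring in the
  entries of the matrix is cut out as the carrier of \<open>CX d k1 k2\<close>.
\<close>

type_synonym var = "nat \<times> (nat \<times> nat)"
type_synonym cpoly = "(var \<Rightarrow>\<^sub>0 nat) \<Rightarrow>\<^sub>0 complex"

definition indets :: "nat \<Rightarrow> nat \<Rightarrow> nat \<Rightarrow> var set" where
  "indets d k1 k2 = {1..d} \<times> ({1..k1} \<times> {1..k2})"

definition CX :: "nat \<Rightarrow> nat \<Rightarrow> nat \<Rightarrow> cpoly ring" where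
  "CX d k1 k2 =
     \<lparr>carrier = {p. \<forall>m \<in> Poly_Mapping.keys p. Poly_Mapping.keys m \<subseteq> indets d k1 k2},
      monoid.mult = (*), one = 1, zero = 0, add = (+)\<rparr>"

definition indet :: "nat \<Rightarrow> nat \<times> nat \<Rightarrow> cpoly" where
  "indet i c = Poly_Mapping.single (Poly_Mapping.single (i, c) 1) 1"

text \<open>
  The \<open>r\<close>-minors of the submatrix of the generic matrix with rows in \<open>A\<close> and columns in \<open>C\<close>.
  The chosen rows and columns may be listed in any order, which changes a minor only by a sign.
\<close>

definition minors :: "nat \<Rightarrow> nat set \<Rightarrow> (nat \<times> nat) set \<Rightarrow> cpoly set" where
  "minors r A C =
     {det (mat r r (\<lambda>(a, b). indet (rs ! a) (cs ! b))) | rs cs.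
        length rs = r \<and> distinct rs \<and> set rs \<subseteq> A \<and>
        length cs = r \<and> distinct cs \<and> set cs \<subseteq> C}"

definition minor_ideal :: "nat \<Rightarrow> nat \<Rightarrow> nat \<Rightarrow> nat \<Rightarrow> (nat \<times> nat) set \<Rightarrow> cpoly set" where
  "minor_ideal d k1 k2 r C = Idl\<^bsub>CX d k1 k2\<^esub> (minors r {1..d} C)"

definition block_cols :: "nat \<Rightarrow> nat \<Rightarrow> (nat \<times> nat) set" where
  "block_cols k1 i = {1..k1} \<times> {i}"

definition family_sum :: "('a, 'b) ring_scheme \<Rightarrow> 'i set \<Rightarrow> ('i \<Rightarrow> 'a set) \<Rightarrow> 'a set" where
  "family_sum R S I = {finsum R f S | f. f \<in> Pi S I}"

definition I_empty :: "nat \<Rightarrow> nat \<Rightarrow> nat \<Rightarrow> nat \<Rightarrow> cpoly set" where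
  "I_empty d k1 k2 t =
     minor_ideal d k1 k2 t ({1..k1} \<times> {1..k2})
     <+>\<^bsub>CX d k1 k2\<^esub>
     family_sum (CX d k1 k2) {1..k2} (\<lambda>i. minor_ideal d k1 k2 2 (block_cols k1 i))"

end

theory Submission
  imports Defs "HOL-Library.Product_Lexorder"
begin

text \<open>
  The ideal is the kernel of a homomorphism into a domain, and hence prime. With \<open>s = t - 1\<close>, the
  homomorphism is the generic point
  \<open>x\<^bsub>i(j,l)\<^esub> \<mapsto> a\<^bsub>jl\<^esub> (\<Sum>h<s. b\<^bsub>ih\<^esub> c\<^bsub>hl\<^esub>)\<close>
  of the variety of matrices of rank less than \<open>t\<close> whose blocks have rank at most 1. The
  generating minors vanish there, since the matrix factors through dimension \<open>s\<close> and each block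
  through dimension 1 (\<open>I_empty_subset_param_kernel\<close>). The other inclusion is a standard monomial
  argument.

  Call a monomial normal if it is divisible neither by the main diagonal of a \<open>t\<close>-minor with
  columns in \<open>t\<close> increasing blocks nor by the main diagonal of a 2-minor inside a block. The weight
  of a monomial sums \<open>i * l\<close> over its variables \<open>x\<^bsub>i(j,l)\<^esub>\<close> and breaks ties by the sum of
  \<open>i * j\<close>. By the rearrangement inequality the main diagonal is the heaviest term of such a
  minor, so subtracting multiples of these minors rewrites every polynomial into a combination of
  normal monomials (\<open>normal_form_exists\<close>).

  It remains to see that the images of normal monomials are linearly independent
  (\<open>normal_polynomials_independent\<close>). The variables of a normal monomial \<open>A\<close> contain no chain
  of length \<open>t\<close> in rows and blocks, so they split into \<open>s\<close> antichains, numbered by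
  \<open>h\<close> (\<open>layering_of_bounded_chains\<close>). Choosing for each variable its own \<open>h\<close> in the sum above
  gives one term of the image of \<open>A\<close>. A monomial whose image contains the same term has the same
  rows and the same blocks in each antichain, and the same columns in each block; only the pairing may
  differ. Antichains are antitone pairings, which by the rearrangement inequality
  (\<open>rearrangement_mset\<close>) have strictly smaller weight than all other pairings of the same data.
  So this term singles out \<open>A\<close> among all monomials of at most its weight
  (\<open>normal_coefficient_triangular\<close>), and as coefficients of images count choices of indices, its
  coefficient is not 0. Hence a nonzero combination of normal monomials has a nonzero image.
\<close>

section \<open>The rearrangement inequality for multisets\<close>

definition quadrant :: "('k \<times> nat \<times> nat) multiset \<Rightarrow> 'k \<Rightarrow> nat \<Rightarrow> nat \<Rightarrow> nat" where
  "quadrant Z k p q = size (filter_mset (\<lambda>(k', r, s). k' = k \<and> p \<le> r \<and> q \<le> s) Z)"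

definition antitone_mset :: "('k \<times> nat \<times> nat) multiset \<Rightarrow> bool" where
  "antitone_mset Z \<longleftrightarrow>
     (\<forall>k r s r' s'. (k, r, s) \<in># Z \<longrightarrow> (k, r', s') \<in># Z \<longrightarrow> r < r' \<longrightarrow> s' \<le> s)"

lemma quadrant_inclusion_exclusion:
  "count Z (k, r, s) + quadrant Z k (Suc r) s + quadrant Z k r (Suc s) =
   quadrant Z k r s + quadrant Z k (Suc r) (Suc s)"
  by (induction Z) (auto simp: quadrant_def Suc_le_eq not_less order_antisym)

lemma quadrant_eqD:
  fixes Z Z' :: "('k \<times> nat \<times> nat) multiset"
  assumes "\<And>k p q. quadrant Z k p q = quadrant Z' k p q"
  shows "Z = Z'"
proof (rule multiset_eqI)
  fix x :: "'k \<times> nat \<times> nat"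
  obtain k r s where "x = (k, r, s)" by (cases x)
  then show "count Z x = count Z' x"
    using quadrant_inclusion_exclusion[of Z k r s] quadrant_inclusion_exclusion[of Z' k r s] assms
    by simp
qed

text \<open>
  A product \<open>r * s\<close> of natural numbers counts the corners \<open>(p, q)\<close> with \<open>1 \<le> p \<le> r\<close> and
  \<open>1 \<le> q \<le> s\<close>, and every quadrant count collects the pairs that see its corner. This turns
  a sum of products into a sum of quadrant counts, which can be compared termwise.
\<close>

lemma sum_mset_products_eq_sum_quadrant:
  assumes "finite K" "\<And>k r s. (k, r, s) \<in># Z \<Longrightarrow> k \<in> K \<and> r \<le> P \<and> s \<le> P"
  shows "(\<Sum>(k, r, s)\<in>#Z. r * s) = (\<Sum>k\<in>K. \<Sum>p=1..P. \<Sum>q=1..P. quadrant Z k p q)"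
  using assms(2)
proof (induction Z)
  case empty
  then show ?case by (simp add: quadrant_def)
next
  case (add x Z)
  obtain k r s where x: "x = (k, r, s)" by (cases x)
  have b: "k \<in> K" "r \<le> P" "s \<le> P" using add.prems[of k r s] x by auto
  have q: "quadrant (add_mset x Z) k' p q =
      (if k' = k then if p \<le> r then if q \<le> s then 1 else 0 else 0 else 0) + quadrant Z k' p q" for k' p q
    by (auto simp: quadrant_def x)
  have i: "{Suc 0..P} \<inter> {q. q \<le> r} = {Suc 0..r}" if "r \<le> P" for r using that by auto
  have "(\<Sum>k'\<in>K. \<Sum>p=1..P. \<Sum>q=1..P. (if k' = k then if p \<le> r then if q \<le> s then 1 else 0 else 0 else (0::nat)))
     = (\<Sum>k'\<in>K. if k' = k then \<Sum>p=1..P. if p \<le> r then \<Sum>q=1..P. if q \<le> s then 1 else 0 else 0 else (0::nat))"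
    by (auto intro!: sum.cong)
  also have "\<dots> = r * s"
    using b assms(1) by (simp add: sum.If_cases i)
  finally have "(\<Sum>k'\<in>K. \<Sum>p=1..P. \<Sum>q=1..P. quadrant (add_mset x Z) k' p q) =
      r * s + (\<Sum>k'\<in>K. \<Sum>p=1..P. \<Sum>q=1..P. quadrant Z k' p q)"
    unfolding q sum.distrib by simp
  moreover have "(\<Sum>(k, r, s)\<in>#Z. r * s) = (\<Sum>k'\<in>K. \<Sum>p=1..P. \<Sum>q=1..P. quadrant Z k' p q)"
    by (rule add.IH) (use add.prems in auto)
  ultimately show ?case by (simp add: x)
qed

text \<open>
  Inclusion and exclusion expresses the size of a quadrant through the two projections and the
  number of pairs in the opposite quadrant. For fixed projections a quadrant is therefore smallest
  when it or its opposite is empty, and antitonicity forces one of the two: a pair in each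
  would be strictly comparable.
\<close>

lemma quadrant_le_of_antitone:
  assumes Z: "antitone_mset Z"
    and rows: "image_mset (\<lambda>(k, r, s). (k, r)) Z = image_mset (\<lambda>(k, r, s). (k, r)) Z'"
    and cols: "image_mset (\<lambda>(k, r, s). (k, s)) Z = image_mset (\<lambda>(k, r, s). (k, s)) Z'"
  shows "quadrant Z k p q \<le> quadrant Z' k p q"
proof -
  define row where "row = (\<lambda>Y :: ('a \<times> nat \<times> nat) multiset.
     size (filter_mset (\<lambda>(k', r). k' = k \<and> p \<le> r) (image_mset (\<lambda>(k, r, s). (k, r)) Y)))"
  define col where "col = (\<lambda>Y :: ('a \<times> nat \<times> nat) multiset.
     size (filter_mset (\<lambda>(k', s). k' = k \<and> q \<le> s) (image_mset (\<lambda>(k, r, s). (k, s)) Y)))"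
  define all where "all = (\<lambda>Y :: ('a \<times> nat \<times> nat) multiset.
     size (filter_mset (\<lambda>(k', r). k' = k) (image_mset (\<lambda>(k, r, s). (k, r)) Y)))"
  define neither where "neither = (\<lambda>Y :: ('a \<times> nat \<times> nat) multiset.
     size (filter_mset (\<lambda>(k', r, s). k' = k \<and> r < p \<and> s < q) Y))"
  have ie: "row Y + col Y + neither Y = all Y + quadrant Y k p q" for Y
    by (induction Y) (auto simp: row_def col_def all_def neither_def quadrant_def)
  have same: "row Z = row Z'" "col Z = col Z'" "all Z = all Z'"
    using rows cols by (simp_all add: row_def col_def all_def)
  have "quadrant Z k p q = 0 \<or> neither Z = 0"
  proof (rule ccontr)
    assume "\<not> ?thesis"
    then obtain r s r' s' where "(k, r, s) \<in># Z" "p \<le> r" "q \<le> s" "(k, r', s') \<in># Z" "r' < p" "s' < q"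
      by (auto simp: quadrant_def neither_def)
    moreover from this have "r' < r" by simp
    ultimately have "s \<le> s'" using Z unfolding antitone_mset_def by blast
    then show False using \<open>q \<le> s\<close> \<open>s' < q\<close> by simp
  qed
  then show ?thesis using ie[of Z] ie[of Z'] same by auto
qed

text \<open>
  The rearrangement inequality with its equality case, for several keys at once. All quadrant
  counts of an antitone multiset are minimal, so equality of the sums makes them all equal, and the
  quadrant counts determine the multiset.
\<close>

lemma rearrangement_mset:
  assumes Z: "antitone_mset Z"
    and rows: "image_mset (\<lambda>(k, r, s). (k, r)) Z = image_mset (\<lambda>(k, r, s). (k, r)) Z'"
    and cols: "image_mset (\<lambda>(k, r, s). (k, s)) Z = image_mset (\<lambda>(k, r, s). (k, s)) Z'"
  shows "(\<Sum>(k, r, s)\<in>#Z. r * s) \<le> (\<Sum>(k, r, s)\<in>#Z'. r * s)"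
    and "(\<Sum>(k, r, s)\<in>#Z. r * s) = (\<Sum>(k, r, s)\<in>#Z'. r * s) \<Longrightarrow> Z = Z'"
proof -
  define F where "F = set_mset (Z + Z')"
  define K where "K = fst ` F"
  define P where "P = Max (insert 0 ((fst \<circ> snd) ` F \<union> (snd \<circ> snd) ` F))"
  have fin: "finite F" "finite K" by (simp_all add: F_def K_def)
  have bd: "k \<in> K \<and> r \<le> P \<and> s \<le> P" if "(k, r, s) \<in> F" for k r s
    unfolding K_def P_def using fin(1) that by (force intro!: Max_ge)
  have eqZ: "(\<Sum>(k, r, s)\<in>#Z. r * s) = (\<Sum>k\<in>K. \<Sum>p=1..P. \<Sum>q=1..P. quadrant Z k p q)"
    by (rule sum_mset_products_eq_sum_quadrant) (use fin bd in \<open>auto simp: F_def\<close>)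
  have eqZ': "(\<Sum>(k, r, s)\<in>#Z'. r * s) = (\<Sum>k\<in>K. \<Sum>p=1..P. \<Sum>q=1..P. quadrant Z' k p q)"
    by (rule sum_mset_products_eq_sum_quadrant) (use fin bd in \<open>auto simp: F_def\<close>)
  note le = quadrant_le_of_antitone[OF assms]
  show "(\<Sum>(k, r, s)\<in>#Z. r * s) \<le> (\<Sum>(k, r, s)\<in>#Z'. r * s)"
    unfolding eqZ eqZ' by (intro sum_mono le)
  assume "(\<Sum>(k, r, s)\<in>#Z. r * s) = (\<Sum>(k, r, s)\<in>#Z'. r * s)"
  then have sums: "(\<Sum>k\<in>K. \<Sum>p=1..P. \<Sum>q=1..P. quadrant Z k p q) =
      (\<Sum>k\<in>K. \<Sum>p=1..P. \<Sum>q=1..P. quadrant Z' k p q)"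
    using eqZ eqZ' by simp
  have inner: "quadrant Z k p q = quadrant Z' k p q" if "k \<in> K" "p \<in> {1..P}" "q \<in> {1..P}" for k p q
  proof -
    have "(\<Sum>p=1..P. \<Sum>q=1..P. quadrant Z k p q) = (\<Sum>p=1..P. \<Sum>q=1..P. quadrant Z' k p q)"
      using sum_mono_inv[OF sums _ that(1) fin(2)] by (simp add: sum_mono le)
    from sum_mono_inv[OF this _ that(2)]
    have "(\<Sum>q=1..P. quadrant Z k p q) = (\<Sum>q=1..P. quadrant Z' k p q)"
      by (simp add: sum_mono le)
    from sum_mono_inv[OF this _ that(3)] show ?thesis by (simp add: le)
  qed
  \<comment> \<open>The sums only see positive corners; quadrants on the axes are counts of a projection.\<close>
  have row0: "quadrant Y k 0 q = size (filter_mset (\<lambda>(k', s). k' = k \<and> q \<le> s)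
      (image_mset (\<lambda>(k, r, s). (k, s)) Y))" for Y :: "('a \<times> nat \<times> nat) multiset" and k q
    by (induction Y) (auto simp: quadrant_def)
  have col0: "quadrant Y k p 0 = size (filter_mset (\<lambda>(k', r). k' = k \<and> p \<le> r)
      (image_mset (\<lambda>(k, r, s). (k, r)) Y))" for Y :: "('a \<times> nat \<times> nat) multiset" and k p
    by (induction Y) (auto simp: quadrant_def)
  have outside: "quadrant Y k p q = 0" if "set_mset Y \<subseteq> F" "k \<notin> K \<or> P < p \<or> P < q" for Y k p q
    using that bd by (fastforce simp: quadrant_def filter_mset_eq_mempty_iff)
  have "quadrant Z k p q = quadrant Z' k p q" for k p q
  proof (cases "p = 0 \<or> q = 0")
    case True
    then show ?thesis using row0 col0 rows cols by metis
  next
    case False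
    show ?thesis
    proof (cases "k \<in> K \<and> p \<le> P \<and> q \<le> P")
      case True
      then show ?thesis using False inner by simp
    next
      case out: False
      then show ?thesis using outside[of Z k p q] outside[of Z' k p q]
        by (auto simp: F_def)
    qed
  qed
  then show "Z = Z'" by (rule quadrant_eqD)
qed

text \<open>
  The increasing arrangement gives the strictly largest sum. The substitution
  \<open>c \<mapsto> C - c\<close> with a common upper bound \<open>C\<close> turns this into the minimality of
  antitone arrangements.
\<close>

lemma rearrangement_permutes:
  fixes r c :: "nat \<Rightarrow> nat"
  assumes r: "strict_mono_on {..<n} r" and c: "strict_mono_on {..<n} c"
    and p: "p permutes {..<n}" "p \<noteq> id"
  shows "(\<Sum>k<n. r k * c (p k)) < (\<Sum>k<n. r k * c k)"
proof -
  define C where "C = Max (insert 0 (c ` {..<n}))"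
  have C: "c k \<le> C" if "k < n" for k unfolding C_def using that by (intro Max_ge) auto
  have pn: "p k < n" if "k < n" for k using p(1) that by (metis permutes_in_image lessThan_iff)
  define Z where "Z = (\<lambda>q. image_mset (\<lambda>k. ((), r k, C - c (q k))) (mset_set {..<n}))"
  have sumZ: "(\<Sum>(k, r, s)\<in>#Z q. r * s) = (\<Sum>k<n. r k * (C - c (q k)))" for q
    by (simp add: Z_def sum_unfold_sum_mset multiset.map_comp comp_def)
  have add: "(\<Sum>k<n. r k * (C - c (q k))) + (\<Sum>k<n. r k * c (q k)) = (\<Sum>k<n. r k * C)"
    if "\<And>k. k < n \<Longrightarrow> q k < n" for q
    unfolding sum.distrib[symmetric] 
    by (intro sum.cong refl) (use that C in \<open>simp add: add_mult_distrib2[symmetric]\<close>)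
  have anti: "antitone_mset (Z id)"
    unfolding antitone_mset_def
  proof (intro allI impI)
    fix u x s x' s' assume "(u, x, s) \<in># Z id" "(u, x', s') \<in># Z id" and lt: "x < x'"
    then obtain k k' where k: "k < n" "k' < n" "x = r k" "x' = r k'" "s = C - c k" "s' = C - c k'"
      by (auto simp: Z_def)
    then have "k < k'" using lt r by (metis strict_mono_on_less lessThan_iff)
    then have "c k \<le> c k'" using c k(1,2) by (simp add: strict_mono_onD less_imp_le)
    then show "s' \<le> s" using k by simp
  qed
  have rows: "image_mset (\<lambda>(k, r, s). (k, r)) (Z id) = image_mset (\<lambda>(k, r, s). (k, r)) (Z p)"
    by (simp add: Z_def multiset.map_comp comp_def)
  have "image_mset p (mset_set {..<n}) = mset_set {..<n}"
    using permutes_image[OF p(1)] permutes_inj_on[OF p(1)] by (metis image_mset_mset_set)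
  then have "image_mset (\<lambda>k. ((), C - c k)) (image_mset p (mset_set {..<n})) =
             image_mset (\<lambda>k. ((), C - c k)) (mset_set {..<n})" by simp
  then have cols: "image_mset (\<lambda>(k, r, s). (k, s)) (Z id) = image_mset (\<lambda>(k, r, s). (k, s)) (Z p)"
    by (simp add: Z_def multiset.map_comp comp_def)
  note R = rearrangement_mset[OF anti rows cols, unfolded sumZ]
  have "Z id \<noteq> Z p"
  proof
    assume eq: "Z id = Z p"
    have "p k = k" if k: "k < n" for k
    proof -
      have "((), r k, C - c (p k)) \<in># Z id" unfolding eq using k by (auto simp: Z_def)
      then obtain k' where k': "k' < n" "r k = r k'" "C - c (p k) = C - c k'" by (auto simp: Z_def)
      have "k' = k" using k' k r by (metis strict_mono_on_eqD lessThan_iff)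
      moreover have "c (p k) = c k'" using k'(1,3) C[of k'] C[of "p k"] pn[OF k] by simp
      ultimately show ?thesis using c pn[OF k] k by (metis strict_mono_on_eqD lessThan_iff)
    qed
    then have "p = id" using p(1) by (metis permutes_not_in lessThan_iff eq_id_iff)
    then show False using p(2) by simp
  qed
  then have "(\<Sum>k<n. r k * (C - c (id k))) < (\<Sum>k<n. r k * (C - c (p k)))"
    using R by (auto simp: order_less_le)
  then show ?thesis using add[of id] add[of p] pn by simp
qed

text \<open>
  The minimal elements form one antichain, and every chain of the remaining elements can be
  prolonged below, so induction on \<open>n\<close> splits the set into \<open>n\<close> antichains.
  The antichain of an element will serve as its summation index in the parametrization.
\<close>

lemma layering_of_bounded_chains:
  assumes R: "transp R"
    and "\<And>xs. sorted_wrt R xs \<Longrightarrow> set xs \<subseteq> S \<Longrightarrow> length xs \<le> n"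
  shows "\<exists>h. (\<forall>x\<in>S. h x < n) \<and> (\<forall>x\<in>S. \<forall>y\<in>S. R x y \<longrightarrow> h x \<noteq> (h y :: nat))"
  using assms(2)
proof (induction n arbitrary: S)
  case 0
  have "S = {}"
  proof (rule ccontr)
    assume "S \<noteq> {}"
    then obtain x where "x \<in> S" by blast
    then show False using 0[of "[x]"] by simp
  qed
  then show ?case by simp
next
  case (Suc n)
  define S' where "S' = {x \<in> S. \<exists>y\<in>S. R y x}"
  have "length xs \<le> n" if xs: "sorted_wrt R xs" "set xs \<subseteq> S'" for xs
  proof (cases xs)
    case (Cons x ys)
    then obtain y where y: "y \<in> S" "R y x" using xs(2) by (auto simp: S'_def)
    have "sorted_wrt R (y # xs)" using xs(1) y(2) Cons R by (auto dest: transpD)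
    moreover have "set (y # xs) \<subseteq> S" using xs(2) y(1) by (auto simp: S'_def)
    ultimately show ?thesis using Suc.prems[of "y # xs"] by simp
  qed simp
  then obtain h where h: "\<forall>x\<in>S'. h x < n" "\<forall>x\<in>S'. \<forall>y\<in>S'. R x y \<longrightarrow> h x \<noteq> h y"
    using Suc.IH[of S'] by auto
  show ?case
    by (rule exI[of _ "\<lambda>x. if x \<in> S' then Suc (h x) else 0"]) (use h in \<open>auto simp: S'_def\<close>)
qed

section \<open>Monomials and substitution homomorphisms\<close>

definition exponents :: "'v multiset \<Rightarrow> ('v \<Rightarrow>\<^sub>0 nat)" where
  "exponents A = (\<Sum>v\<in>#A. Poly_Mapping.single v 1)"

text \<open>
  Monomials are exponent vectors in the polynomial ring but are easier to combine and to count as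
  multisets of variables; \<open>exponents\<close> and \<open>variables\<close> are inverse translations.
\<close>

definition variables :: "('v \<Rightarrow>\<^sub>0 nat) \<Rightarrow> 'v multiset" where
  "variables m = Abs_multiset (Poly_Mapping.lookup m)"

lemma lookup_exponents [simp]: "Poly_Mapping.lookup (exponents A) v = count A v"
  by (induction A) (auto simp: exponents_def lookup_add lookup_single)

lemma count_variables [simp]: "count (variables m) v = Poly_Mapping.lookup m v"
  by (simp add: variables_def count_Abs_multiset finite_lookup_nat)

lemma exponents_variables [simp]: "exponents (variables m) = m"
  by (rule poly_mapping_eqI) simp

lemma variables_exponents [simp]: "variables (exponents A) = A"
  by (rule multiset_eqI) simp

lemma variables_add: "variables (m + n) = variables m + variables n"
  by (rule multiset_eqI) (simp add: lookup_add)

lemma set_mset_variables: "set_mset (variables m) = Poly_Mapping.keys m"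
  by (auto simp: set_mset_def in_keys_iff)

lemma exponents_add: "exponents (A + B) = exponents A + exponents B"
  by (simp add: exponents_def)

lemma exponents_eq_iff: "exponents A = exponents B \<longleftrightarrow> A = B"
  by (metis variables_exponents)

text \<open>
  The homomorphism of polynomial rings that sends each indeterminate \<open>v\<close> to \<open>g v\<close> and fixes
  the coefficients.
\<close>

definition substitute :: "('v \<Rightarrow> ('w :: comm_monoid_add \<Rightarrow>\<^sub>0 'a)) \<Rightarrow> (('v \<Rightarrow>\<^sub>0 nat) \<Rightarrow>\<^sub>0 'a :: comm_ring_1) \<Rightarrow> ('w \<Rightarrow>\<^sub>0 'a)" where
  "substitute g p = (\<Sum>m\<in>Poly_Mapping.keys p.
     Poly_Mapping.single 0 (Poly_Mapping.lookup p m) * (\<Prod>v\<in>#variables m. g v))"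

lemma poly_mapping_eq_sum_single:
  "p = (\<Sum>m\<in>Poly_Mapping.keys p. Poly_Mapping.single m (Poly_Mapping.lookup p m))"
proof (rule poly_mapping_eqI)
  fix k
  show "Poly_Mapping.lookup p k = Poly_Mapping.lookup (\<Sum>m\<in>Poly_Mapping.keys p. Poly_Mapping.single m (Poly_Mapping.lookup p m)) k"
    by (cases "k \<in> Poly_Mapping.keys p")
      (auto simp: lookup_sum lookup_single when_def in_keys_iff)
qed

lemma substitute_add: "substitute g (p + q) = substitute g p + substitute g q"
  unfolding substitute_def
  by (rule setsum_keys_plus_distrib[where f = "\<lambda>m c. Poly_Mapping.single 0 c * (\<Prod>v\<in>#variables m. g v)"])
    (simp_all add: single_add distrib_right)

lemma substitute_single:
  "substitute g (Poly_Mapping.single m c) = Poly_Mapping.single 0 c * (\<Prod>v\<in>#variables m. g v)"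
  by (cases "c = 0") (simp_all add: substitute_def)

lemma substitute_zero [simp]: "substitute g 0 = 0"
  by (simp add: substitute_def)

lemma substitute_sum: "substitute g (sum f S) = (\<Sum>s\<in>S. substitute g (f s))"
  by (induction S rule: infinite_finite_induct) (simp_all add: substitute_add)

lemma substitute_one [simp]:
  fixes g :: "'v \<Rightarrow> ('w :: comm_monoid_add \<Rightarrow>\<^sub>0 'a :: comm_ring_1)"
  shows "substitute g 1 = 1"
proof -
  have "variables (0 :: 'v \<Rightarrow>\<^sub>0 nat) = {#}" by (rule multiset_eqI) simp
  then show ?thesis using substitute_single[of g 0 1] unfolding single_one by simp
qed

lemma substitute_mult:
  fixes g :: "'v \<Rightarrow> ('w :: comm_monoid_add \<Rightarrow>\<^sub>0 'a :: comm_ring_1)"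
  shows "substitute g (p * q) = substitute g p * substitute g q"
proof -
  have mono: "substitute g (Poly_Mapping.single m c * Poly_Mapping.single n e) =
      substitute g (Poly_Mapping.single m c) * substitute g (Poly_Mapping.single n e)" for m n c e
  proof -
    have "Poly_Mapping.single (0 :: 'w) (c * e) = Poly_Mapping.single 0 c * Poly_Mapping.single 0 e"
      by (simp add: mult_single)
    then show ?thesis
      by (simp only: mult_single[of m] substitute_single variables_add image_mset_union prod_mset.union mult_ac)
  qed
  let ?p = "\<Sum>m\<in>Poly_Mapping.keys p. Poly_Mapping.single m (Poly_Mapping.lookup p m)"
  let ?q = "\<Sum>m\<in>Poly_Mapping.keys q. Poly_Mapping.single m (Poly_Mapping.lookup q m)"
  have "substitute g (?p * ?q) = substitute g ?p * substitute g ?q"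
    by (simp add: sum_product substitute_sum mono)
  then show ?thesis by (simp flip: poly_mapping_eq_sum_single)
qed

lemma comm_ring_hom_substitute: "comm_ring_hom (substitute g)"
  by unfold_locales (simp_all add: substitute_add substitute_mult)

definition mono_of :: "'v multiset \<Rightarrow> (('v \<Rightarrow>\<^sub>0 nat) \<Rightarrow>\<^sub>0 'a :: comm_ring_1)" where
  "mono_of A = Poly_Mapping.single (exponents A) 1"

lemma exponents_empty [simp]: "exponents {#} = 0"
  by (simp add: exponents_def)

lemma mono_of_empty [simp]: "mono_of {#} = 1"
  by (simp add: mono_of_def)

lemma mono_of_add: "mono_of (A + B) = mono_of A * mono_of B"
  by (simp add: mono_of_def exponents_add mult_single)

lemma mono_of_sum: "mono_of (sum f S) = (\<Prod>x\<in>S. mono_of (f x))"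
  by (induction S rule: infinite_finite_induct) (simp_all add: mono_of_add)

lemma indet_eq_mono_of: "indet i c = mono_of {#(i, c)#}"
  by (simp add: indet_def mono_of_def exponents_def)

lemma substitute_mono_of: "substitute g (mono_of A) = (\<Prod>v\<in>#A. g v)"
  by (simp add: mono_of_def substitute_single)

lemma lookup_single_0_mult:
  "Poly_Mapping.lookup (Poly_Mapping.single 0 c * p) k = c * Poly_Mapping.lookup p k"
  by (simp add: Poly_Mapping.map.rep_eq when_def flip: mult_map_scale_conv_mult)

lemma lookup_substitute:
  "Poly_Mapping.lookup (substitute g p) k = (\<Sum>m\<in>Poly_Mapping.keys p.
     Poly_Mapping.lookup p m * Poly_Mapping.lookup (substitute g (mono_of (variables m))) k)"
  by (simp add: substitute_def[of g p] lookup_sum lookup_single_0_mult substitute_mono_of)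

section \<open>Independence of normal monomials under the parametrization\<close>

lemma mset_eq_image_nth: "mset xs = image_mset ((!) xs) (mset_set {..<length xs})"
  by (metis atLeast0LessThan map_nth mset_map mset_set_upto_eq_mset_upto)

text \<open>
  The monomial \<open>a\<^bsub>jl\<^esub> b\<^bsub>ih\<^esub> c\<^bsub>hl\<^esub>\<close> as a multiset. The three families of parameters live in the
  same type of variables as the matrix entries and are told apart by the tags 0, 1 and 2.
\<close>

fun labels :: "var \<Rightarrow> nat \<Rightarrow> var multiset" where
  "labels (i, (j, l)) h = {#(0, (j, l)), (1, (i, h)), (2, (h, l))#}"

text \<open>
  The generic point of the variety: column \<open>(j, l)\<close> is \<open>a\<^bsub>jl\<^esub>\<close> times column \<open>l\<close> of a product
  of a matrix \<open>b\<close> with \<open>s\<close> columns and a matrix \<open>c\<close> with \<open>s\<close> rows.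
\<close>

definition param :: "nat \<Rightarrow> var \<Rightarrow> cpoly" where
  "param s x = (\<Sum>h<s. mono_of (labels x h))"

text \<open>
  Multiplying out the image of a monomial means choosing a summation index for each of its
  variables. All terms have coefficient 1, so coefficients of the image are numbers of choices and
  nothing cancels.
\<close>

lemma lookup_substitute_param:
  "Poly_Mapping.lookup (substitute (param s) (mono_of (mset xs))) (exponents B) =
   of_nat (card {g \<in> {..<length xs} \<rightarrow>\<^sub>E {..<s}. (\<Sum>k<length xs. labels (xs ! k) (g k)) = B})"
proof -
  have "substitute (param s) (mono_of (mset xs)) = (\<Prod>k<length xs. \<Sum>h<s. mono_of (labels (xs ! k) h))"
    by (subst mset_eq_image_nth)
      (simp add: substitute_mono_of param_def multiset.map_comp comp_def prod_unfold_prod_mset)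
  also have "\<dots> = (\<Sum>g\<in>{..<length xs} \<rightarrow>\<^sub>E {..<s}. mono_of (\<Sum>k<length xs. labels (xs ! k) (g k)))"
    by (simp add: prod_sum_PiE mono_of_sum)
  also have "Poly_Mapping.lookup \<dots> (exponents B) =
      (\<Sum>g\<in>{..<length xs} \<rightarrow>\<^sub>E {..<s}. if (\<Sum>k<length xs. labels (xs ! k) (g k)) = B then 1 else 0)"
    by (simp add: lookup_sum mono_of_def lookup_single when_def exponents_eq_iff)
  also have "\<dots> = of_nat (card {g \<in> {..<length xs} \<rightarrow>\<^sub>E {..<s}. (\<Sum>k<length xs. labels (xs ! k) (g k)) = B})"
    by (simp add: sum.If_cases finite_PiE Int_def)
  finally show ?thesis .
qed

lemma lookup_substitute_param_nonzeroD:
  assumes "Poly_Mapping.lookup (substitute (param s) (mono_of A)) (exponents B) \<noteq> 0"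
  obtains Z where "image_mset fst Z = A" "(\<Sum>(x, h)\<in>#Z. labels x h) = B"
proof -
  obtain xs where xs: "mset xs = A" using ex_mset by blast
  obtain g where g: "(\<Sum>k<length xs. labels (xs ! k) (g k)) = B"
    using assms unfolding xs[symmetric] lookup_substitute_param by (auto simp: card_eq_0_iff)
  define Z where "Z = image_mset (\<lambda>k. (xs ! k, g k)) (mset_set {..<length xs})"
  have "image_mset fst Z = A"
    by (simp add: Z_def multiset.map_comp comp_def flip: xs mset_eq_image_nth)
  moreover have "(\<Sum>(x, h)\<in>#Z. labels x h) = B"
    unfolding Z_def g[symmetric] by (simp add: multiset.map_comp comp_def flip: sum_unfold_sum_mset)
  ultimately show thesis by (rule that)
qed

lemma lookup_substitute_param_nonzeroI:
  assumes "\<And>x. x \<in># A \<Longrightarrow> h x < s"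
  shows "Poly_Mapping.lookup (substitute (param s) (mono_of A)) (exponents (\<Sum>x\<in>#A. labels x (h x))) \<noteq> 0"
proof -
  obtain xs where xs: "mset xs = A" using ex_mset by blast
  let ?g = "\<lambda>k\<in>{..<length xs}. h (xs ! k)"
  let ?B = "\<Sum>x\<in>#mset xs. labels x (h x)"
  have "(\<Sum>k<length xs. labels (xs ! k) (?g k)) = ?B"
    by (subst mset_eq_image_nth) (simp add: multiset.map_comp comp_def flip: sum_unfold_sum_mset)
  moreover have "h (xs ! k) < s" if "k < length xs" for k
    using assms[of "xs ! k"] xs that by auto
  then have "?g \<in> {..<length xs} \<rightarrow>\<^sub>E {..<s}" by auto
  ultimately have "{g \<in> {..<length xs} \<rightarrow>\<^sub>E {..<s}. (\<Sum>k<length xs. labels (xs ! k) (g k)) = ?B} \<noteq> {}"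
    by blast
  then show ?thesis
    unfolding xs[symmetric] lookup_substitute_param by (simp add: card_eq_0_iff finite_PiE)
qed

text \<open>
  Comparing these pairs lexicographically orders monomials so that the main diagonal is the largest
  term of every minor that matters: the first entry decides for minors with columns in distinct blocks, and
  it is constant on the minors inside one block, where the second entry decides.
\<close>

definition weight :: "var multiset \<Rightarrow> nat \<times> nat" where
  "weight A = ((\<Sum>(i, (j, l))\<in>#A. i * l), (\<Sum>(i, (j, l))\<in>#A. i * j))"

text \<open>
  The main diagonal of a minor with columns in increasing blocks is a list sorted by
  \<open>block_chain\<close>; the main diagonal of a 2-minor inside one block is a pair related by
  \<open>column_chain\<close>. A normal monomial is divisible by no diagonal of size \<open>s + 1\<close> of the first
  kind and by no diagonal of the second kind.
\<close>

definition block_chain :: "var \<Rightarrow> var \<Rightarrow> bool" where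
  "block_chain = (\<lambda>(i, (j, l)) (i', (j', l')). i < i' \<and> l < l')"

definition column_chain :: "var \<Rightarrow> var \<Rightarrow> bool" where
  "column_chain = (\<lambda>(i, (j, l)) (i', (j', l')). l = l' \<and> i < i' \<and> j < j')"

definition normal_monomial :: "nat \<Rightarrow> var multiset \<Rightarrow> bool" where
  "normal_monomial s A \<longleftrightarrow>
     (\<forall>vs. sorted_wrt block_chain vs \<longrightarrow> set vs \<subseteq> set_mset A \<longrightarrow> length vs \<le> s) \<and>
     (\<forall>v\<in>#A. \<forall>v'\<in>#A. \<not> column_chain v v')"

text \<open>
  The product of all labels remembers exactly which pairs \<open>(j, l)\<close>, \<open>(i, h)\<close> and \<open>(h, l)\<close> occur,
  but not which variables they come from.
\<close>

lemma labels_marginals: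
  fixes Z :: "(var \<times> nat) multiset"
  shows "image_mset (\<lambda>((i, (j, l)), h). (j, l)) Z =
      image_mset snd (filter_mset (\<lambda>v. fst v = 0) (\<Sum>(x, h)\<in>#Z. labels x h))"
    and "image_mset (\<lambda>((i, (j, l)), h). (i, h)) Z =
      image_mset snd (filter_mset (\<lambda>v. fst v = 1) (\<Sum>(x, h)\<in>#Z. labels x h))"
    and "image_mset (\<lambda>((i, (j, l)), h). (h, l)) Z =
      image_mset snd (filter_mset (\<lambda>v. fst v = 2) (\<Sum>(x, h)\<in>#Z. labels x h))"
  by (induction Z) auto

text \<open>
  Let every variable of a normal monomial \<open>A\<close> use its antichain as summation index. If the
  resulting term also occurs in the image of \<open>A'\<close>, then \<open>A'\<close> arises from \<open>A\<close> by pairing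
  the same rows and blocks anew inside each antichain, and the same rows and columns inside each
  block. The pairings in \<open>A\<close> are antitone, so by the rearrangement inequality any other
  pairing has larger weight.
\<close>

lemma normal_coefficient_triangular:
  assumes A: "normal_monomial s A"
    and h: "\<And>x y. x \<in># A \<Longrightarrow> y \<in># A \<Longrightarrow> block_chain x y \<Longrightarrow> h x \<noteq> h y"
    and nz: "Poly_Mapping.lookup (substitute (param s) (mono_of A')) (exponents (\<Sum>x\<in>#A. labels x (h x))) \<noteq> 0"
  shows "A' = A \<or> weight A < weight A'"
proof -
  define Z where "Z = image_mset (\<lambda>x. (x, h x)) A"
  have Z: "image_mset fst Z = A" by (simp add: Z_def multiset.map_comp comp_def)
  obtain Z' where Z': "image_mset fst Z' = A'"
    and labels: "(\<Sum>(x, h)\<in>#Z'. labels x h) = (\<Sum>(x, h)\<in>#Z. labels x h)"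
    using lookup_substitute_param_nonzeroD[OF nz] by (auto simp: Z_def multiset.map_comp comp_def)
  note marginals = labels_marginals[of Z', unfolded labels, folded labels_marginals[of Z]]
  \<comment> \<open>First entry of the weight: the key is the summation index.\<close>
  define Y where "Y = image_mset (\<lambda>((i, (j, l)), h). (h, i, l)) Z"
  define Y' where "Y' = image_mset (\<lambda>((i, (j, l)), h). (h, i, l)) Z'"
  have "antitone_mset Y"
    using h by (fastforce simp: antitone_mset_def Y_def Z_def block_chain_def not_less[symmetric])
  moreover have "image_mset (\<lambda>(k, r, s). (k, r)) Y = image_mset (\<lambda>(k, r, s). (k, r)) Y'"
    using arg_cong[OF marginals(2), of "image_mset (\<lambda>(a, b). (b, a))"]
    by (simp add: Y_def Y'_def multiset.map_comp comp_def case_prod_unfold)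
  moreover have "image_mset (\<lambda>(k, r, s). (k, s)) Y = image_mset (\<lambda>(k, r, s). (k, s)) Y'"
    using marginals(3)
    by (simp add: Y_def Y'_def multiset.map_comp comp_def case_prod_unfold)
  ultimately have R1: "(\<Sum>(k, r, s)\<in>#Y. r * s) \<le> (\<Sum>(k, r, s)\<in>#Y'. r * s)"
      "(\<Sum>(k, r, s)\<in>#Y. r * s) = (\<Sum>(k, r, s)\<in>#Y'. r * s) \<Longrightarrow> Y = Y'"
    using rearrangement_mset[of Y Y'] by blast+
  have w1: "fst (weight A) = (\<Sum>(k, r, s)\<in>#Y. r * s)" "fst (weight A') = (\<Sum>(k, r, s)\<in>#Y'. r * s)"
    by (simp_all add: weight_def Y_def Y'_def Z[symmetric] Z'[symmetric] multiset.map_comp comp_def case_prod_unfold)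
  \<comment> \<open>Second entry of the weight: the key is the block.\<close>
  define V where "V = image_mset (\<lambda>(i, (j, l)). (l, i, j)) A"
  define V' where "V' = image_mset (\<lambda>(i, (j, l)). (l, i, j)) A'"
  have w2: "snd (weight A) = (\<Sum>(k, r, s)\<in>#V. r * s)" "snd (weight A') = (\<Sum>(k, r, s)\<in>#V'. r * s)"
    by (simp_all add: weight_def V_def V'_def multiset.map_comp comp_def case_prod_unfold)
  show ?thesis
  proof (cases "fst (weight A) = fst (weight A')")
    case False
    then have "fst (weight A) < fst (weight A')" using R1(1) w1 by simp
    then show ?thesis by (simp add: less_prod_def')
  next
    case True
    then have YY: "Y = Y'" using R1(2) w1 by simp
    have "antitone_mset V"
      using A by (fastforce simp: antitone_mset_def V_def normal_monomial_def column_chain_def not_less[symmetric])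
    moreover have "image_mset (\<lambda>(k, r, s). (k, r)) V = image_mset (\<lambda>(k, r, s). (k, r)) V'"
      using arg_cong[OF YY, of "image_mset (\<lambda>(h, i, l). (l, i))"]
      by (simp add: Y_def Y'_def V_def V'_def Z[symmetric] Z'[symmetric] multiset.map_comp comp_def case_prod_unfold)
    moreover have "image_mset (\<lambda>(k, r, s). (k, s)) V = image_mset (\<lambda>(k, r, s). (k, s)) V'"
      using arg_cong[OF marginals(1), of "image_mset (\<lambda>(a, b). (b, a))"]
      by (simp add: V_def V'_def Z[symmetric] Z'[symmetric] multiset.map_comp comp_def case_prod_unfold)
    ultimately have R2: "(\<Sum>(k, r, s)\<in>#V. r * s) \<le> (\<Sum>(k, r, s)\<in>#V'. r * s)"
        "(\<Sum>(k, r, s)\<in>#V. r * s) = (\<Sum>(k, r, s)\<in>#V'. r * s) \<Longrightarrow> V = V'"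
      using rearrangement_mset[of V V'] by blast+
    show ?thesis
    proof (cases "snd (weight A) = snd (weight A')")
      case True
      then have "V = V'" using R2(2) w2 by simp
      then have "image_mset (\<lambda>(l, i, j). (i, (j, l))) V = image_mset (\<lambda>(l, i, j). (i, (j, l))) V'" by simp
      then have "A = A'" by (simp add: V_def V'_def multiset.map_comp comp_def case_prod_unfold)
      then show ?thesis by simp
    next
      case False
      then have "snd (weight A) < snd (weight A')" using R2(1) w2 by simp
      then show ?thesis using True by (simp add: less_prod_def')
    qed
  qed
qed

text \<open>
  For a normal monomial of largest weight in \<open>q\<close>, the term in which every variable uses its
  antichain as summation index occurs in the image of no other monomial of \<open>q\<close>, so it survives
  in the image of \<open>q\<close>.
\<close>

lemma normal_polynomials_independent:
  assumes normal: "\<And>m. m \<in> Poly_Mapping.keys q \<Longrightarrow> normal_monomial s (variables m)"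
    and zero: "substitute (param s) q = 0"
  shows "q = 0"
proof (rule ccontr)
  assume "q \<noteq> 0"
  define M where "M = Max ((\<lambda>m. weight (variables m)) ` Poly_Mapping.keys q)"
  have "M \<in> (\<lambda>m. weight (variables m)) ` Poly_Mapping.keys q"
    unfolding M_def using \<open>q \<noteq> 0\<close> by (intro Max_in) auto
  then obtain m where m: "m \<in> Poly_Mapping.keys q" "weight (variables m) = M" by auto
  have max: "weight (variables m') \<le> weight (variables m)" if "m' \<in> Poly_Mapping.keys q" for m'
    unfolding m(2) M_def using that by (intro Max_ge) auto
  define A where "A = variables m"
  have A: "normal_monomial s A" using normal m by (simp add: A_def)
  have "transp block_chain" by (auto simp: transp_def block_chain_def)
  then obtain h where h: "\<forall>x\<in>#A. h x < s" "\<forall>x\<in>#A. \<forall>y\<in>#A. block_chain x y \<longrightarrow> h x \<noteq> h y"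
    using layering_of_bounded_chains[of block_chain "set_mset A" s] A unfolding normal_monomial_def by auto
  let ?B = "\<Sum>x\<in>#A. labels x (h x)"
  have "Poly_Mapping.lookup (substitute (param s) (mono_of (variables m'))) (exponents ?B) = 0"
    if m': "m' \<in> Poly_Mapping.keys q - {m}" for m'
  proof (rule ccontr)
    assume "\<not> ?thesis"
    then have "variables m' = A \<or> weight A < weight (variables m')"
      using normal_coefficient_triangular[OF A, of h] h(2) by blast
    then show False
      using m' max[of m'] by (metis A_def DiffE exponents_variables insertI1 leD)
  qed
  then have "Poly_Mapping.lookup (substitute (param s) q) (exponents ?B) =
      Poly_Mapping.lookup q m * Poly_Mapping.lookup (substitute (param s) (mono_of A)) (exponents ?B)"
    by (simp add: lookup_substitute[of "param s" q] sum.remove[OF _ m(1)] A_def)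
  moreover have "Poly_Mapping.lookup q m \<noteq> 0" using m(1) by (simp add: in_keys_iff)
  moreover have "Poly_Mapping.lookup (substitute (param s) (mono_of A)) (exponents ?B) \<noteq> 0"
    by (rule lookup_substitute_param_nonzeroI) (use h in auto)
  ultimately show False using zero by simp
qed

section \<open>Leading terms of minors\<close>

definition det_term :: "nat list \<Rightarrow> (nat \<times> nat) list \<Rightarrow> (nat \<Rightarrow> nat) \<Rightarrow> var multiset" where
  "det_term rs cs p = (\<Sum>k<length rs. {#(rs ! k, cs ! p k)#})"

lemma det_term_id: "det_term (map fst vs) (map snd vs) id = mset vs"
proof -
  have "(\<Sum>k<length vs. {#vs ! k#}) = mset vs"
    by (induction vs rule: rev_induct) (simp_all add: nth_append)
  then show ?thesis by (simp add: det_term_def)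
qed

lemma det_indet_eq:
  assumes "length rs = r" "length cs = r"
  shows "det (mat r r (\<lambda>(a, b). indet (rs ! a) (cs ! b))) =
    (\<Sum>p | p permutes {..<r}. of_int (sign p) * mono_of (det_term rs cs p))"
proof -
  have "(\<Prod>i = 0..<r. mat r r (\<lambda>(a, b). indet (rs ! a) (cs ! b)) $$ (i, p i)) = mono_of (det_term rs cs p)"
    if p: "p permutes {0..<r}" for p
  proof -
    have "p i < r" if "i < r" for i
      using permutes_in_image[OF p, of i] that by simp
    then show ?thesis
      by (simp add: det_term_def mono_of_sum assms indet_eq_mono_of atLeast0LessThan)
  qed
  then show ?thesis by (simp add: det_def atLeast0LessThan)
qed

lemma weight_add: "weight (A + B) = (fst (weight A) + fst (weight B), snd (weight A) + snd (weight B))"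
  by (simp add: weight_def)

lemma weight_det_term:
  "weight (det_term rs cs p) =
    (\<Sum>k<length rs. rs ! k * snd (cs ! p k), \<Sum>k<length rs. rs ! k * fst (cs ! p k))"
proof -
  have "weight (\<Sum>k\<in>S. {#(rs ! k, cs ! p k)#}) = (\<Sum>k\<in>S. rs ! k * snd (cs ! p k), \<Sum>k\<in>S. rs ! k * fst (cs ! p k))"
    if "finite S" for S
    using that by (induction S) (auto simp: weight_def case_prod_unfold)
  then show ?thesis by (simp add: det_term_def)
qed

lemma strict_mono_on_nth:
  assumes "sorted_wrt (\<lambda>x y. f x < (f y :: nat)) xs"
  shows "strict_mono_on {..<length xs} (\<lambda>k. f (xs ! k))"
  using assms by (auto intro!: strict_mono_onI simp: sorted_wrt_iff_nth_less)

text \<open>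
  The off-diagonal terms of a minor pair the same increasing rows with a permutation of the same
  increasing blocks, which makes the first entry of the weight strictly smaller.
\<close>

lemma weight_det_term_less_block_chain:
  assumes vs: "sorted_wrt block_chain vs"
    and p: "p permutes {..<length vs}" "p \<noteq> id"
  shows "weight (det_term (map fst vs) (map snd vs) p) < weight (mset vs)"
proof -
  note det_term_id[of vs, symmetric]
  moreover have "strict_mono_on {..<length vs} (\<lambda>k. fst (vs ! k))"
    "strict_mono_on {..<length vs} (\<lambda>k. snd (snd (vs ! k)))"
    using vs by (auto intro!: strict_mono_on_nth elim!: sorted_wrt_mono_rel[rotated] simp: block_chain_def)
  moreover have "p k < length vs" if "k < length vs" for k
    using permutes_in_image[OF p(1), of k] that by simp
  ultimately show ?thesis
    using rearrangement_permutes[of "length vs" "\<lambda>k. fst (vs ! k)" "\<lambda>k. snd (snd (vs ! k))" p] p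
    by (simp add: weight_det_term less_prod_def')
qed

text \<open>
  Inside one block the first entry of the weight does not see the permutation, and the second entry
  becomes strictly smaller.
\<close>

lemma weight_det_term_less_column_chain:
  assumes vs: "sorted_wrt column_chain vs"
    and p: "p permutes {..<length vs}" "p \<noteq> id"
  shows "weight (det_term (map fst vs) (map snd vs) p) < weight (mset vs)"
proof -
  note det_term_id[of vs, symmetric]
  moreover have "strict_mono_on {..<length vs} (\<lambda>k. fst (vs ! k))"
    "strict_mono_on {..<length vs} (\<lambda>k. fst (snd (vs ! k)))"
    using vs by (auto intro!: strict_mono_on_nth elim!: sorted_wrt_mono_rel[rotated] simp: column_chain_def)
  moreover have pn: "p k < length vs" if "k < length vs" for k
    using permutes_in_image[OF p(1), of k] that by simp
  moreover have "snd (snd (vs ! p k)) = snd (snd (vs ! k))" if "k < length vs" for k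
  proof -
    have "snd (snd (vs ! a)) = snd (snd (vs ! b))" if "a < b" "b < length vs" for a b
      using sorted_wrt_nth_less[OF vs that] by (auto simp: column_chain_def)
    then show ?thesis using pn[OF that] that by (metis linorder_neqE_nat)
  qed
  ultimately show ?thesis
    using rearrangement_permutes[of "length vs" "\<lambda>k. fst (vs ! k)" "\<lambda>k. fst (snd (vs ! k))" p] p
    by (simp add: weight_det_term less_prod_def')
qed

text \<open>
  Expanding a minor whose main diagonal divides a monomial rewrites that monomial, modulo the minor,
  into the monomials with the diagonal replaced by the other terms.
\<close>

lemma reduction_step:
  assumes vs: "distinct vs" "set vs \<subseteq> set_mset A"
  defines "E \<equiv> A - mset vs"
  shows "mono_of A = mono_of E * det (mat (length vs) (length vs) (\<lambda>(a, b). indet (map fst vs ! a) (map snd vs ! b)))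
     - (\<Sum>p\<in>{p. p permutes {..<length vs}} - {id}.
          of_int (sign p) * mono_of (E + det_term (map fst vs) (map snd vs) p))"
proof -
  have "mset vs \<subseteq># A"
    using vs by (intro mset_subset_eqI) (auto simp: distinct_count_atmost_1 Suc_le_eq)
  then have A: "A = E + mset vs" by (simp add: E_def)
  have "det (mat (length vs) (length vs) (\<lambda>(a, b). indet (map fst vs ! a) (map snd vs ! b))) =
      (\<Sum>p\<in>{p. p permutes {..<length vs}}. of_int (sign p) * mono_of (det_term (map fst vs) (map snd vs) p))"
    by (rule det_indet_eq) auto
  also have "\<dots> = mono_of (mset vs) + (\<Sum>p\<in>{p. p permutes {..<length vs}} - {id}.
       of_int (sign p) * mono_of (det_term (map fst vs) (map snd vs) p))"
    by (subst sum.remove[of _ id]) (auto simp: finite_permutations permutes_id det_term_id)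
  finally show ?thesis
    by (simp add: A mono_of_add distrib_left sum_distrib_left mult.left_commute)
qed

section \<open>The polynomial ring and the ideal\<close>

lemma carrier_CX: "carrier (CX d k1 k2) = {p. \<forall>m \<in> Poly_Mapping.keys p. set_mset (variables m) \<subseteq> indets d k1 k2}"
  by (simp add: CX_def set_mset_variables)

lemma CX_simps [simp]:
  "x \<otimes>\<^bsub>CX d k1 k2\<^esub> y = x * y" "x \<oplus>\<^bsub>CX d k1 k2\<^esub> y = x + y"
  "\<zero>\<^bsub>CX d k1 k2\<^esub> = 0" "\<one>\<^bsub>CX d k1 k2\<^esub> = 1"
  by (simp_all add: CX_def)

lemma CX_zero: "0 \<in> carrier (CX d k1 k2)"
  by (simp add: carrier_CX)

lemma CX_one: "1 \<in> carrier (CX d k1 k2)"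
  by (simp add: CX_def)

lemma CX_add: "p \<in> carrier (CX d k1 k2) \<Longrightarrow> q \<in> carrier (CX d k1 k2) \<Longrightarrow> p + q \<in> carrier (CX d k1 k2)"
  using Poly_Mapping.keys_add[of p q] by (auto simp: CX_def)

lemma CX_uminus: "p \<in> carrier (CX d k1 k2) \<Longrightarrow> - p \<in> carrier (CX d k1 k2)"
  by (auto simp: CX_def in_keys_iff)

lemma CX_mult:
  assumes "p \<in> carrier (CX d k1 k2)" "q \<in> carrier (CX d k1 k2)"
  shows "p * q \<in> carrier (CX d k1 k2)"
  unfolding carrier_CX
proof (intro CollectI ballI)
  fix m assume "m \<in> Poly_Mapping.keys (p * q)"
  then obtain a b where "m = a + b" "a \<in> Poly_Mapping.keys p" "b \<in> Poly_Mapping.keys q"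
    using keys_mult[of p q] by blast
  then show "set_mset (variables m) \<subseteq> indets d k1 k2"
    using assms by (simp add: variables_add carrier_CX)
qed

lemma CX_sum: "(\<And>x. x \<in> S \<Longrightarrow> f x \<in> carrier (CX d k1 k2)) \<Longrightarrow> sum f S \<in> carrier (CX d k1 k2)"
  by (induction S rule: infinite_finite_induct) (simp_all add: CX_zero CX_add)

lemma CX_mono_of: "set_mset A \<subseteq> indets d k1 k2 \<Longrightarrow> mono_of A \<in> carrier (CX d k1 k2)"
  by (simp add: carrier_CX mono_of_def)

lemma CX_of_int_sign: "p \<in> carrier (CX d k1 k2) \<Longrightarrow> of_int (sign f) * p \<in> carrier (CX d k1 k2)"
  by (cases f rule: sign_cases) (simp_all add: CX_uminus)

lemma cring_CX: "cring (CX d k1 k2)"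
proof (rule cringI)
  show "abelian_group (CX d k1 k2)"
  proof (rule abelian_groupI)
    fix x assume "x \<in> carrier (CX d k1 k2)"
    then show "\<exists>y\<in>carrier (CX d k1 k2). y \<oplus>\<^bsub>CX d k1 k2\<^esub> x = \<zero>\<^bsub>CX d k1 k2\<^esub>"
      by (intro bexI[of _ "- x"]) (simp_all add: CX_uminus)
  qed (simp_all add: CX_add CX_zero add_ac)
  show "comm_monoid (CX d k1 k2)"
    by (rule comm_monoidI) (simp_all add: CX_mult CX_one mult_ac)
qed (simp add: distrib_right)

lemma ring_CX: "ring (CX d k1 k2)"
  using cring_CX by (rule cring.axioms(1))

lemma minors_subset_CX:
  assumes "C \<subseteq> {1..k1} \<times> {1..k2}"
  shows "minors r {1..d} C \<subseteq> carrier (CX d k1 k2)"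
proof
  fix x assume "x \<in> minors r {1..d} C"
  then obtain rs cs where x: "x = det (mat r r (\<lambda>(a, b). indet (rs ! a) (cs ! b)))"
    and rs: "length rs = r" "set rs \<subseteq> {1..d}" and cs: "length cs = r" "set cs \<subseteq> C"
    by (auto simp: minors_def)
  have "mono_of (det_term rs cs p) \<in> carrier (CX d k1 k2)" if p: "p permutes {..<r}" for p
  proof (rule CX_mono_of)
    have "p k < r" if "k < r" for k using permutes_in_image[OF p, of k] that by simp
    then have "cs ! p k \<in> set cs" "rs ! k \<in> set rs" if "k < r" for k
      using that by (simp_all add: rs(1) cs(1))
    then have "cs ! p k \<in> {1..k1} \<times> {1..k2}" "rs ! k \<in> {1..d}" if "k < r" for k
      using that assms rs(2) cs(2) by (meson subsetD)+
    then have "(rs ! k, cs ! p k) \<in> indets d k1 k2" if "k < r" for k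
      unfolding indets_def using that by blast
    then show "set_mset (det_term rs cs p) \<subseteq> indets d k1 k2"
      by (auto simp: det_term_def set_mset_sum rs(1))
  qed
  then show "x \<in> carrier (CX d k1 k2)"
    unfolding x det_indet_eq[OF rs(1) cs(1)] by (intro CX_sum CX_of_int_sign) auto
qed

lemma minor_ideal_is_ideal:
  assumes "C \<subseteq> {1..k1} \<times> {1..k2}"
  shows "ideal (minor_ideal d k1 k2 r C) (CX d k1 k2)"
  unfolding minor_ideal_def by (rule ring.genideal_ideal[OF ring_CX minors_subset_CX[OF assms]])

lemma CX_idealD:
  assumes "ideal I (CX d k1 k2)"
  shows "I \<subseteq> carrier (CX d k1 k2)" "0 \<in> I"
    "\<And>x y. x \<in> I \<Longrightarrow> y \<in> I \<Longrightarrow> x + y \<in> I"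
    "\<And>x c. x \<in> I \<Longrightarrow> c \<in> carrier (CX d k1 k2) \<Longrightarrow> c * x \<in> I"
  using ideal.Icarr[OF assms] additive_subgroup.zero_closed[OF ideal.axioms(1)[OF assms]]
    additive_subgroup.a_closed[OF ideal.axioms(1)[OF assms]] ideal.I_l_closed[OF assms]
  by auto

lemma finsum_CX:
  assumes "finite S" "f \<in> S \<rightarrow> carrier (CX d k1 k2)"
  shows "finsum (CX d k1 k2) f S = sum f S"
proof -
  interpret cring "CX d k1 k2" by (rule cring_CX)
  show ?thesis using assms
    by (induction S) (auto simp: finsum_insert)
qed

lemma block_cols_subset: "i \<in> {1..k2} \<Longrightarrow> block_cols k1 i \<subseteq> {1..k1} \<times> {1..k2}"
  by (auto simp: block_cols_def)

text \<open>
  The finite sum of ideals in the definition is an iterated addition in a record; here it becomes an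
  ordinary sum of polynomials, which is what the closure properties below are proved from.
\<close>

lemma I_empty_eq:
  "I_empty d k1 k2 t = {x + (\<Sum>i=1..k2. f i) | x f. x \<in> minor_ideal d k1 k2 t ({1..k1} \<times> {1..k2}) \<and>
      (\<forall>i\<in>{1..k2}. f i \<in> minor_ideal d k1 k2 2 (block_cols k1 i))}"
proof -
  let ?B = "\<lambda>i. minor_ideal d k1 k2 2 (block_cols k1 i)"
  have sum_eq: "finsum (CX d k1 k2) f {1..k2} = sum f {1..k2}" if f: "f \<in> Pi {1..k2} ?B" for f
  proof (rule finsum_CX)
    show "f \<in> {1..k2} \<rightarrow> carrier (CX d k1 k2)"
    proof
      fix i assume i: "i \<in> {1..k2}"
      then show "f i \<in> carrier (CX d k1 k2)"
        using f CX_idealD(1)[OF minor_ideal_is_ideal[OF block_cols_subset[OF i]]] by (meson PiE subsetD)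
    qed
  qed simp
  have "family_sum (CX d k1 k2) {1..k2} ?B = {sum f {1..k2} | f. f \<in> Pi {1..k2} ?B}"
    unfolding family_sum_def using sum_eq by (intro Collect_cong ex_cong1) auto
  then show ?thesis
    unfolding I_empty_def set_add_def' by (simp only: CX_simps Pi_iff) blast
qed

lemma I_empty_memI:
  assumes "x \<in> minor_ideal d k1 k2 t ({1..k1} \<times> {1..k2})"
    and "\<And>i. i \<in> {1..k2} \<Longrightarrow> f i \<in> minor_ideal d k1 k2 2 (block_cols k1 i)"
  shows "x + (\<Sum>i=1..k2. f i) \<in> I_empty d k1 k2 t"
  unfolding I_empty_eq using assms by blast

lemma I_empty_closed:
  shows "0 \<in> I_empty d k1 k2 t"
    and "p \<in> I_empty d k1 k2 t \<Longrightarrow> q \<in> I_empty d k1 k2 t \<Longrightarrow> p + q \<in> I_empty d k1 k2 t"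
    and "p \<in> I_empty d k1 k2 t \<Longrightarrow> c \<in> carrier (CX d k1 k2) \<Longrightarrow> c * p \<in> I_empty d k1 k2 t"
proof -
  let ?J = "minor_ideal d k1 k2 t ({1..k1} \<times> {1..k2})"
  let ?B = "\<lambda>i. minor_ideal d k1 k2 2 (block_cols k1 i)"
  note J = CX_idealD[OF minor_ideal_is_ideal[OF order_refl, of d k1 k2 t]]
  note B = CX_idealD[OF minor_ideal_is_ideal[OF block_cols_subset, of _ k2 d k1 2]]
  show "0 \<in> I_empty d k1 k2 t"
    using I_empty_memI[of 0 d k1 k2 t "\<lambda>_. 0"] J(2) B(2) by simp
  show "p + q \<in> I_empty d k1 k2 t" if pq: "p \<in> I_empty d k1 k2 t" "q \<in> I_empty d k1 k2 t"
  proof -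
    obtain x f where p: "p = x + (\<Sum>i=1..k2. f i)" "x \<in> ?J" "\<forall>i\<in>{1..k2}. f i \<in> ?B i"
      using pq(1) unfolding I_empty_eq by blast
    obtain y g where q: "q = y + (\<Sum>i=1..k2. g i)" "y \<in> ?J" "\<forall>i\<in>{1..k2}. g i \<in> ?B i"
      using pq(2) unfolding I_empty_eq by blast
    have "(x + y) + (\<Sum>i=1..k2. f i + g i) \<in> I_empty d k1 k2 t"
      using p q by (intro I_empty_memI J(3) B(3)) auto
    then show ?thesis by (simp add: p(1) q(1) sum.distrib add_ac)
  qed
  show "c * p \<in> I_empty d k1 k2 t" if pc: "p \<in> I_empty d k1 k2 t" "c \<in> carrier (CX d k1 k2)"
  proof -
    obtain x f where p: "p = x + (\<Sum>i=1..k2. f i)" "x \<in> ?J" "\<forall>i\<in>{1..k2}. f i \<in> ?B i"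
      using pc(1) unfolding I_empty_eq by blast
    have "c * x + (\<Sum>i=1..k2. c * f i) \<in> I_empty d k1 k2 t"
      using p pc(2) by (intro I_empty_memI J(4) B(4)) auto
    then show ?thesis by (simp add: p(1) distrib_left sum_distrib_left)
  qed
qed

lemma I_empty_generators:
  shows "minors t {1..d} ({1..k1} \<times> {1..k2}) \<subseteq> I_empty d k1 k2 t"
    and "i \<in> {1..k2} \<Longrightarrow> minors 2 {1..d} (block_cols k1 i) \<subseteq> I_empty d k1 k2 t"
proof -
  let ?J = "minor_ideal d k1 k2 t ({1..k1} \<times> {1..k2})"
  let ?B = "\<lambda>i. minor_ideal d k1 k2 2 (block_cols k1 i)"
  note J = CX_idealD[OF minor_ideal_is_ideal[OF order_refl, of d k1 k2 t]]
  note B = CX_idealD[OF minor_ideal_is_ideal[OF block_cols_subset, of _ k2 d k1 2]]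
  show "minors t {1..d} ({1..k1} \<times> {1..k2}) \<subseteq> I_empty d k1 k2 t"
  proof
    fix x assume "x \<in> minors t {1..d} ({1..k1} \<times> {1..k2})"
    then have "x \<in> ?J"
      unfolding minor_ideal_def using ring.genideal_self[OF ring_CX minors_subset_CX[OF order_refl]] by blast
    then have "x + (\<Sum>i=1..k2. 0) \<in> I_empty d k1 k2 t"
      using B(2) by (rule I_empty_memI)
    then show "x \<in> I_empty d k1 k2 t" by simp
  qed
  show "minors 2 {1..d} (block_cols k1 i) \<subseteq> I_empty d k1 k2 t" if i: "i \<in> {1..k2}"
  proof
    fix x assume "x \<in> minors 2 {1..d} (block_cols k1 i)"
    then have "x \<in> ?B i"
      unfolding minor_ideal_def using ring.genideal_self[OF ring_CX minors_subset_CX[OF block_cols_subset[OF i]]] by blast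
    then have "0 + (\<Sum>i'=1..k2. if i' = i then x else 0) \<in> I_empty d k1 k2 t"
      using J(2) B(2) by (intro I_empty_memI) auto
    then show "x \<in> I_empty d k1 k2 t" using i by simp
  qed
qed

section \<open>The ideal vanishes under the parametrization\<close>

text \<open>
  A square matrix that factors through a smaller dimension is singular: padding both factors to
  square matrices gives the right one a zero row.
\<close>

lemma det_eq_0_of_factorization:
  fixes f g :: "nat \<Rightarrow> nat \<Rightarrow> 'a :: comm_ring_1"
  assumes "r < n"
  shows "det (mat n n (\<lambda>(a, b). \<Sum>m<r. f a m * g m b)) = 0"
proof -
  define F where "F = mat n n (\<lambda>(a, m). if m < r then f a m else 0)"
  define G where "G = mat\<^sub>r n n (\<lambda>m. if m = r then 0\<^sub>v n else vec n (\<lambda>b. g m b))"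
  have carr: "F \<in> carrier_mat n n" "G \<in> carrier_mat n n" by (auto simp: F_def G_def)
  have "mat n n (\<lambda>(a, b). \<Sum>m<r. f a m * g m b) = F * G"
  proof (rule eq_matI)
    fix a b assume ab: "a < dim_row (F * G)" "b < dim_col (F * G)"
    then have ab: "a < n" "b < n" using carr by auto
    have "(F * G) $$ (a, b) = (\<Sum>m\<in>{0..<n}. F $$ (a, m) * G $$ (m, b))"
      using ab carr by (auto simp: scalar_prod_def intro!: sum.cong)
    also have "\<dots> = (\<Sum>m\<in>{0..<r}. f a m * g m b)"
      by (rule sum.mono_neutral_cong_right) (use ab assms in \<open>auto simp: F_def G_def\<close>)
    finally show "mat n n (\<lambda>(a, b). \<Sum>m<r. f a m * g m b) $$ (a, b) = (F * G) $$ (a, b)"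
      using ab by (simp add: atLeast0LessThan)
  qed (use carr in auto)
  moreover have "det G = 0"
    unfolding G_def by (rule det_row_0[OF assms]) auto
  ultimately show ?thesis using det_mult[OF carr] by simp
qed

lemma param_hom: "comm_ring_hom (substitute (param s))"
  by (rule comm_ring_hom_substitute)

lemma substitute_minor:
  assumes "length rs = r" "length cs = r"
  shows "substitute (param s) (det (mat r r (\<lambda>(a, b). indet (rs ! a) (cs ! b)))) =
    det (mat r r (\<lambda>(a, b). param s (rs ! a, cs ! b)))"
proof -
  interpret comm_ring_hom "substitute (param s)" by (rule param_hom)
  have "map_mat (substitute (param s)) (mat r r (\<lambda>(a, b). indet (rs ! a) (cs ! b))) =
      mat r r (\<lambda>(a, b). param s (rs ! a, cs ! b))"
    by (rule eq_matI) (simp_all add: indet_eq_mono_of substitute_mono_of)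
  then show ?thesis using hom_det[of "mat r r (\<lambda>(a, b). indet (rs ! a) (cs ! b))"] by simp
qed

text \<open>
  Two factorizations of the generic point: the whole matrix is a product through dimension \<open>s\<close>,
  and each block is a product through dimension 1.
\<close>

lemma param_eq_block_product:
  "param s (i, c) = (\<Sum>h<s. mono_of {#(1, (i, h))#} * mono_of {#(0, c), (2, (h, snd c))#})"
proof -
  have "labels (i, c) h = {#(1, (i, h))#} + {#(0, c), (2, (h, snd c))#}" for h
    by (cases c) (simp add: add_mset_commute)
  then show ?thesis by (simp only: param_def mono_of_add)
qed

lemma param_eq_column_product:
  "param s (i, (j, l)) =
    (\<Sum>_<(1::nat). (\<Sum>h<s. mono_of {#(1, (i, h)), (2, (h, l))#}) * mono_of {#(0, (j, l))#})"
proof -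
  have "labels (i, (j, l)) h = {#(1, (i, h)), (2, (h, l))#} + {#(0, (j, l))#}" for h
    by (simp add: add_mset_commute)
  then have "param s (i, (j, l)) = (\<Sum>h<s. mono_of {#(1, (i, h)), (2, (h, l))#} * mono_of {#(0, (j, l))#})"
    by (simp only: param_def mono_of_add)
  then show ?thesis by (simp add: sum_distrib_right)
qed

lemma substitute_minor_eq_0:
  assumes "x \<in> minors r A C" "s < r"
  shows "substitute (param s) x = 0"
proof -
  obtain rs cs where x: "x = det (mat r r (\<lambda>(a, b). indet (rs ! a) (cs ! b)))"
    and len: "length rs = r" "length cs = r"
    using assms by (auto simp: minors_def)
  show ?thesis
    unfolding x substitute_minor[OF len] param_eq_block_product
    by (rule det_eq_0_of_factorization[OF assms(2)])
qed

lemma substitute_block_minor_eq_0: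
  assumes "x \<in> minors 2 A (block_cols k1 l)"
  shows "substitute (param s) x = 0"
proof -
  obtain rs cs where x: "x = det (mat 2 2 (\<lambda>(a, b). indet (rs ! a) (cs ! b)))"
    and len: "length rs = 2" "length cs = 2" and cs: "set cs \<subseteq> block_cols k1 l"
    using assms by (auto simp: minors_def)
  have cs_l: "cs ! b = (fst (cs ! b), l)" if "b < 2" for b
    using subsetD[OF cs nth_mem[of b cs]] that len by (auto simp: block_cols_def prod_eq_iff)
  have "param s (i, cs ! b) =
      (\<Sum>_<(1::nat). (\<Sum>h<s. mono_of {#(1, (i, h)), (2, (h, l))#}) * mono_of {#(0, cs ! b)#})"
    if "b < 2" for i b
    using param_eq_column_product[of s i "fst (cs ! b)" l] unfolding cs_l[OF that, symmetric] .
  then have "mat 2 2 (\<lambda>(a, b). param s (rs ! a, cs ! b)) = mat 2 2 (\<lambda>(a, b).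
      \<Sum>_<(1::nat). (\<Sum>h<s. mono_of {#(1, (rs ! a, h)), (2, (h, l))#}) * mono_of {#(0, cs ! b)#})"
    by (intro cong_mat) auto
  moreover have "det \<dots> = 0"
    by (rule det_eq_0_of_factorization) simp
  ultimately show ?thesis
    unfolding x substitute_minor[OF len] by simp
qed

definition param_kernel :: "nat \<Rightarrow> nat \<Rightarrow> nat \<Rightarrow> nat \<Rightarrow> cpoly set" where
  "param_kernel d k1 k2 s = {p \<in> carrier (CX d k1 k2). substitute (param s) p = 0}"

text \<open>
  The target of the parametrization is a polynomial ring over a field, hence a domain.
\<close>

lemma primeideal_param_kernel: "primeideal (param_kernel d k1 k2 s) (CX d k1 k2)"
proof (rule primeidealI)
  interpret R: cring "CX d k1 k2" by (rule cring_CX)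
  interpret h: comm_ring_hom "substitute (param s)" by (rule param_hom)
  let ?K = "param_kernel d k1 k2 s"
  show "cring (CX d k1 k2)" by (rule cring_CX)
  show "ideal ?K (CX d k1 k2)"
  proof (rule idealI)
    show "subgroup ?K (add_monoid (CX d k1 k2))"
    proof (rule R.add.subgroupI)
      fix a assume a: "a \<in> ?K"
      then have "\<ominus>\<^bsub>CX d k1 k2\<^esub> a = - a"
        by (intro R.minus_equality) (auto simp: param_kernel_def CX_uminus)
      then show "\<ominus>\<^bsub>CX d k1 k2\<^esub> a \<in> ?K"
        using a by (simp add: param_kernel_def CX_uminus h.hom_uminus)
    qed (auto simp: param_kernel_def CX_add CX_zero h.hom_add intro!: exI[of _ 0])
  qed (auto simp: param_kernel_def CX_mult h.hom_mult R.ring_axioms)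
  show "carrier (CX d k1 k2) \<noteq> ?K"
  proof
    assume "carrier (CX d k1 k2) = ?K"
    then have "substitute (param s) 1 = 0" using CX_one[of d k1 k2] unfolding param_kernel_def by blast
    then show False by simp
  qed
  show "a \<in> ?K \<or> b \<in> ?K" if "a \<in> carrier (CX d k1 k2)" "b \<in> carrier (CX d k1 k2)" "a \<otimes>\<^bsub>CX d k1 k2\<^esub> b \<in> ?K" for a b
    using that by (auto simp: param_kernel_def h.hom_mult)
qed

lemma minor_ideal_subset_param_kernel:
  assumes "C \<subseteq> {1..k1} \<times> {1..k2}"
    and "\<And>x. x \<in> minors r {1..d} C \<Longrightarrow> substitute (param s) x = 0"
  shows "minor_ideal d k1 k2 r C \<subseteq> param_kernel d k1 k2 s"
  unfolding minor_ideal_def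
  by (rule ring.genideal_minimal[OF ring_CX primeideal.axioms(1)[OF primeideal_param_kernel]])
    (use minors_subset_CX[OF assms(1)] assms(2) in \<open>auto simp: param_kernel_def\<close>)

text \<open>
  Both kinds of generating minors vanish on the generic point, because there the corresponding
  submatrices factor through a dimension smaller than the size of the minor.
\<close>

lemma I_empty_subset_param_kernel:
  assumes "s < t"
  shows "I_empty d k1 k2 t \<subseteq> param_kernel d k1 k2 s"
proof
  fix p assume "p \<in> I_empty d k1 k2 t"
  then obtain x f where p: "p = x + (\<Sum>i=1..k2. f i)"
    and x: "x \<in> minor_ideal d k1 k2 t ({1..k1} \<times> {1..k2})"
    and f: "\<And>i. i \<in> {1..k2} \<Longrightarrow> f i \<in> minor_ideal d k1 k2 2 (block_cols k1 i)"
    unfolding I_empty_eq by blast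
  have "x \<in> param_kernel d k1 k2 s"
    using minor_ideal_subset_param_kernel[of "{1..k1} \<times> {1..k2}" k1 k2 t d s] substitute_minor_eq_0 assms x
    by blast
  moreover have "f i \<in> param_kernel d k1 k2 s" if "i \<in> {1..k2}" for i
    using minor_ideal_subset_param_kernel[OF block_cols_subset[OF that], of 2 d k1 s] substitute_block_minor_eq_0 f[OF that]
    by blast
  ultimately have "x + (\<Sum>i=1..k2. f i) \<in> carrier (CX d k1 k2)"
      "substitute (param s) (x + (\<Sum>i=1..k2. f i)) = 0"
    unfolding param_kernel_def substitute_add substitute_sum by (blast intro: CX_add CX_sum, simp)
  then show "p \<in> param_kernel d k1 k2 s"
    unfolding p param_kernel_def by simp
qed

section \<open>Rewriting modulo the ideal\<close>

definition normal_polys :: "nat \<Rightarrow> nat \<Rightarrow> nat \<Rightarrow> nat \<Rightarrow> cpoly set" where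
  "normal_polys d k1 k2 s =
     {q \<in> carrier (CX d k1 k2). \<forall>m\<in>Poly_Mapping.keys q. normal_monomial s (variables m)}"

lemma normal_polys_zero: "0 \<in> normal_polys d k1 k2 s"
  by (simp add: normal_polys_def CX_zero)

lemma normal_polys_add:
  "p \<in> normal_polys d k1 k2 s \<Longrightarrow> q \<in> normal_polys d k1 k2 s \<Longrightarrow> p + q \<in> normal_polys d k1 k2 s"
  using Poly_Mapping.keys_add[of p q] by (auto simp: normal_polys_def CX_add)

lemma normal_polys_scale:
  "p \<in> normal_polys d k1 k2 s \<Longrightarrow> Poly_Mapping.single 0 c * p \<in> normal_polys d k1 k2 s"
  by (auto simp: normal_polys_def CX_def in_keys_iff lookup_single_0_mult)

lemma normal_polys_sum:
  "(\<And>x. x \<in> S \<Longrightarrow> f x \<in> normal_polys d k1 k2 s) \<Longrightarrow> sum f S \<in> normal_polys d k1 k2 s"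
  by (induction S rule: infinite_finite_induct) (simp_all add: normal_polys_zero normal_polys_add)

lemma distinct_map_of_strictly_increasing:
  assumes "sorted_wrt (\<lambda>x y. f x < f y) xs"
  shows "distinct (map f xs :: 'a :: linorder list)"
proof -
  have "sorted_wrt (<) (map f xs)" using assms by (simp add: sorted_wrt_map)
  then show ?thesis by (simp add: strict_sorted_iff)
qed

lemma minorI:
  assumes "sorted_wrt (\<lambda>v v'. fst v < fst v') vs" "distinct (map snd vs)" "snd ` set vs \<subseteq> C"
    "fst ` set vs \<subseteq> A" "length vs = r"
  shows "det (mat r r (\<lambda>(a, b). indet (map fst vs ! a) (map snd vs ! b))) \<in> minors r A C"
proof -
  have "distinct (map fst vs)"
    using assms(1) by (rule distinct_map_of_strictly_increasing)
  then show ?thesis unfolding minors_def using assms by (intro CollectI exI conjI refl) auto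
qed

lemma not_normal_cases:
  assumes "\<not> normal_monomial s A"
  obtains (block) vs where "sorted_wrt block_chain vs" "set vs \<subseteq> set_mset A" "length vs = Suc s"
    | (column) v v' where "column_chain v v'" "v \<in># A" "v' \<in># A"
proof (cases "\<exists>v\<in>#A. \<exists>v'\<in>#A. column_chain v v'")
  case True
  then show thesis using column by blast
next
  case False
  then obtain vs where vs: "sorted_wrt block_chain vs" "set vs \<subseteq> set_mset A" "\<not> length vs \<le> s"
    using assms unfolding normal_monomial_def by blast
  show thesis
    by (rule block[of "take (Suc s) vs"]) (use vs in \<open>auto intro: sorted_wrt_take dest: in_set_takeD\<close>)
qed

text \<open>
  A monomial that is not normal is divisible by the main diagonal of a generator of the ideal, and
  that diagonal is the term of largest weight in the generator.
\<close>

lemma not_normal_leading_minor: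
  assumes "\<not> normal_monomial s A" and A: "set_mset A \<subseteq> indets d k1 k2"
  obtains vs where "distinct vs" "set vs \<subseteq> set_mset A"
    "det (mat (length vs) (length vs) (\<lambda>(a, b). indet (map fst vs ! a) (map snd vs ! b))) \<in> I_empty d k1 k2 (Suc s)"
    "\<And>p. p permutes {..<length vs} \<Longrightarrow> p \<noteq> id \<Longrightarrow>
       weight (det_term (map fst vs) (map snd vs) p) < weight (mset vs)"
  using assms(1)
proof (cases rule: not_normal_cases)
  case (block vs)
  have rows: "sorted_wrt (\<lambda>v v'. fst v < fst v') vs"
    using block(1) by (auto elim!: sorted_wrt_mono_rel[rotated] simp: block_chain_def)
  have "sorted_wrt (\<lambda>v v'. snd (snd v) < snd (snd v')) vs"
    using block(1) by (auto elim!: sorted_wrt_mono_rel[rotated] simp: block_chain_def)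
  then have "distinct (map (\<lambda>v. snd (snd v)) vs)" by (rule distinct_map_of_strictly_increasing)
  then have cols: "distinct (map snd vs)"
    by (auto simp: distinct_map inj_on_def)
  have "det (mat (length vs) (length vs) (\<lambda>(a, b). indet (map fst vs ! a) (map snd vs ! b)))
      \<in> minors (Suc s) {1..d} ({1..k1} \<times> {1..k2})"
    unfolding block(3) by (rule minorI[OF rows cols])
      (use block A in \<open>auto simp: indets_def\<close>)
  then show thesis
    using that[of vs] cols block weight_det_term_less_block_chain[OF block(1)]
      I_empty_generators(1)[of "Suc s" d k1 k2] by (auto simp: distinct_map)
next
  case (column v v')
  define l where "l = snd (snd v)"
  have cc: "sorted_wrt column_chain [v, v']" using column by simp
  have l: "l \<in> {1..k2}" using column(2) A by (force simp: l_def indets_def)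
  have "det (mat 2 2 (\<lambda>(a, b). indet (map fst [v, v'] ! a) (map snd [v, v'] ! b)))
      \<in> minors 2 {1..d} (block_cols k1 l)"
    by (rule minorI) (use column A in \<open>auto simp: indets_def column_chain_def l_def block_cols_def\<close>)
  then have "det (mat 2 2 (\<lambda>(a, b). indet (map fst [v, v'] ! a) (map snd [v, v'] ! b)))
      \<in> I_empty d k1 k2 (Suc s)"
    using I_empty_generators(2)[OF l] by blast
  moreover have len: "length [v, v'] = 2" by simp
  ultimately have minor: "det (mat (length [v, v']) (length [v, v'])
      (\<lambda>(a, b). indet (map fst [v, v'] ! a) (map snd [v, v'] ! b))) \<in> I_empty d k1 k2 (Suc s)"
    by (simp only: len)
  show thesis
  proof (rule that)
    show "distinct [v, v']" using column(1) by (auto simp: column_chain_def)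
    show "set [v, v'] \<subseteq> set_mset A" using column by simp
  qed (fact minor, rule weight_det_term_less_column_chain[OF cc])
qed

lemma CX_const: "Poly_Mapping.single 0 c \<in> carrier (CX d k1 k2)"
  by (auto simp: CX_def)

lemma I_empty_combination:
  assumes "\<And>x. x \<in> S \<Longrightarrow> f x \<in> I_empty d k1 k2 t"
  shows "(\<Sum>x\<in>S. Poly_Mapping.single 0 (c x) * f x) \<in> I_empty d k1 k2 t"
  using assms
proof (induction S rule: infinite_finite_induct)
  case (insert x S)
  then show ?case
    using I_empty_closed(2)[OF I_empty_closed(3)[OF _ CX_const]] by simp
qed (simp_all add: I_empty_closed(1))

text \<open>
  Rewriting by such generators terminates because pairs of natural numbers are well-ordered
  lexicographically.
\<close>

lemma normal_form_exists:
  assumes "set_mset A \<subseteq> indets d k1 k2"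
  shows "\<exists>q\<in>normal_polys d k1 k2 s. mono_of A - q \<in> I_empty d k1 k2 (Suc s)"
  using assms
proof (induction "weight A" arbitrary: A rule: less_induct)
  case less
  let ?I = "I_empty d k1 k2 (Suc s)"
  show ?case
  proof (cases "normal_monomial s A")
    case True
    then have "mono_of A \<in> normal_polys d k1 k2 s"
      using CX_mono_of[OF less.prems] by (simp add: normal_polys_def) (simp add: mono_of_def)
    then show ?thesis using I_empty_closed(1) by (intro bexI[of _ "mono_of A"]) auto
  next
    case False
    then obtain vs where vs: "distinct vs" "set vs \<subseteq> set_mset A"
      and minor: "det (mat (length vs) (length vs) (\<lambda>(a, b). indet (map fst vs ! a) (map snd vs ! b))) \<in> ?I"
      and less_weight: "\<And>p. p permutes {..<length vs} \<Longrightarrow> p \<noteq> id \<Longrightarrow>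
         weight (det_term (map fst vs) (map snd vs) p) < weight (mset vs)"
      using not_normal_leading_minor[OF _ less.prems] by blast
    define E where "E = A - mset vs"
    define P where "P = {p. p permutes {..<length vs}} - {id}"
    let ?B = "\<lambda>p. E + det_term (map fst vs) (map snd vs) p"
    have AE: "A = E + mset vs"
      unfolding E_def using vs
      by (intro subset_mset.diff_add[symmetric] mset_subset_eqI) (auto simp: distinct_count_atmost_1 Suc_le_eq)
    have "\<exists>q\<in>normal_polys d k1 k2 s. mono_of (?B p) - q \<in> ?I" if p: "p \<in> P" for p
    proof (rule less.hyps)
      show "weight (?B p) < weight A"
        unfolding AE using less_weight[of p] p by (auto simp: P_def weight_add less_prod_def')
      have "(fst (vs ! k), snd (vs ! p k)) \<in> indets d k1 k2" if k: "k < length vs" for k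
      proof -
        have "p k < length vs" using p k permutes_in_image[of p "{..<length vs}" k] by (simp add: P_def)
        then have "vs ! k \<in> indets d k1 k2" "vs ! p k \<in> indets d k1 k2"
          using k vs(2) less.prems nth_mem by blast+
        then show ?thesis by (auto simp: indets_def)
      qed
      moreover have "p k < length vs" if k: "k < length vs" for k
        using p k permutes_in_image[of p "{..<length vs}" k] by (simp add: P_def)
      ultimately show "set_mset (?B p) \<subseteq> indets d k1 k2"
        using less.prems by (auto simp: E_def det_term_def set_mset_sum dest: in_diffD)
    qed
    then obtain q where q: "\<And>p. p \<in> P \<Longrightarrow> q p \<in> normal_polys d k1 k2 s"
        "\<And>p. p \<in> P \<Longrightarrow> mono_of (?B p) - q p \<in> ?I"
      by metis
    \<comment> \<open>The off-diagonal terms enter the rewritten monomial with the opposite sign.\<close>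
    let ?c = "\<lambda>p. Poly_Mapping.single 0 (of_int (- sign p)) :: cpoly"
    have c: "?c p = - of_int (sign p)" for p by (simp add: single_uminus)
    have "mono_of A - (\<Sum>p\<in>P. ?c p * q p) =
        mono_of E * det (mat (length vs) (length vs) (\<lambda>(a, b). indet (map fst vs ! a) (map snd vs ! b)))
        + (\<Sum>p\<in>P. ?c p * (mono_of (?B p) - q p))"
      unfolding reduction_step[OF vs] E_def[symmetric] P_def[symmetric]
      by (simp only: c right_diff_distrib sum_subtractf minus_mult_left[symmetric] sum_negf) (simp)
    also have "\<dots> \<in> ?I"
    proof (rule I_empty_closed(2)[OF I_empty_closed(3)[OF minor] I_empty_combination])
      show "mono_of (?B p) - q p \<in> ?I" if "p \<in> P" for p using q(2) that .
      show "mono_of E \<in> carrier (CX d k1 k2)"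
        using less.prems by (intro CX_mono_of) (auto simp: E_def dest: in_diffD)
    qed
    finally show ?thesis
      using q(1) by (intro bexI[of _ "\<Sum>p\<in>P. ?c p * q p"] normal_polys_sum normal_polys_scale)
  qed
qed

section \<open>Primality\<close>

text \<open>
  Modulo the ideal, an element of the kernel is a combination of normal monomials; that combination
  still lies in the kernel, so it is 0 by independence.
\<close>

lemma param_kernel_subset_I_empty: "param_kernel d k1 k2 s \<subseteq> I_empty d k1 k2 (Suc s)"
proof
  fix p assume p: "p \<in> param_kernel d k1 k2 s"
  let ?I = "I_empty d k1 k2 (Suc s)"
  let ?M = "\<lambda>m. mono_of (variables m) :: cpoly"
  let ?c = "\<lambda>m. Poly_Mapping.single 0 (Poly_Mapping.lookup p m) :: cpoly"
  have "\<forall>m\<in>Poly_Mapping.keys p. \<exists>q\<in>normal_polys d k1 k2 s. ?M m - q \<in> ?I"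
    using p normal_form_exists by (auto simp: param_kernel_def carrier_CX)
  then obtain q where q: "\<And>m. m \<in> Poly_Mapping.keys p \<Longrightarrow> q m \<in> normal_polys d k1 k2 s"
      "\<And>m. m \<in> Poly_Mapping.keys p \<Longrightarrow> ?M m - q m \<in> ?I"
    by metis
  define Q where "Q = (\<Sum>m\<in>Poly_Mapping.keys p. ?c m * q m)"
  have Q: "Q \<in> normal_polys d k1 k2 s"
    unfolding Q_def using q(1) by (intro normal_polys_sum normal_polys_scale)
  have "(\<Sum>m\<in>Poly_Mapping.keys p. ?c m * (?M m - q m)) \<in> ?I"
    using q(2) by (rule I_empty_combination)
  moreover have "(\<Sum>m\<in>Poly_Mapping.keys p. ?c m * ?M m) = p"
    by (simp add: mono_of_def mult_single flip: poly_mapping_eq_sum_single)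
  ultimately have pQ: "p - Q \<in> ?I"
    unfolding Q_def by (simp add: right_diff_distrib sum_subtractf)
  then have "substitute (param s) (p - Q) = 0"
    using I_empty_subset_param_kernel[of s "Suc s" d k1 k2] by (auto simp: param_kernel_def)
  then have "substitute (param s) Q = 0"
    using p substitute_add[of "param s" "p - Q" Q] by (simp add: param_kernel_def)
  then have "Q = 0"
    using Q normal_polynomials_independent[of Q s] by (simp add: normal_polys_def)
  then show "p \<in> ?I" using pQ by simp
qed

theorem theorem4p7:
  fixes k1 k2 d t :: nat
  assumes "2 \<le> k1" and "2 \<le> t" and "t \<le> min k2 d"
  shows "primeideal (I_empty d k1 k2 t) (CX d k1 k2)"
proof -
  define s where "s = t - 1"
  have t: "t = Suc s" using assms(2) by (simp add: s_def)
  have "I_empty d k1 k2 t = param_kernel d k1 k2 s"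
    using I_empty_subset_param_kernel[of s t d k1 k2] param_kernel_subset_I_empty[of d k1 k2 s] t by auto
  then show ?thesis using primeideal_param_kernel by simp
qed

end
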